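(* Let $G$ be a maximal planar graph, let $v$ be a vertex of $G$ of degree $5$, and let $\Gamma(v)=\{v_1,v_2,v_3,v_4,v_5\}$ be its neighbors, labelled in cyclic order around $v$ (so that $v_1v_2v_3v_4v_5v_1$ is the cycle of the wheel $W_5$ centred at $v$). Put $G_1=(G-v)\circ\{v_2,v_5\}$, $G_2=(G-v)\circ\{v_2,v_4\}$, $G_3=(G-v)\circ\{v_3,v_5\}$. Then $$f(G,4)=\big[f(G_1,4)-f(G_1\cup\{v_1v_4,v_1v_3\},4)\big]+\big[f(G_2,4)-f(G_2\cup\{v_3v_1,v_3v_5\},4)\big]+\big[f(G_3,4)-f(G_3\cup\{v_4v_1\},4)\big].$$
   Context: Graphs are finite and undirected. A maximal planar graph is a planar graph to which no edge can be added without violating planarity; equivalently, a planar graph with all faces (including the infinite one) triangles. $f(G,t)$ is the chromatic polynomial: the number of proper vertex colorings of the labelled graph $G$ with $t$ colors. For vertices $u,w$ of a graph $H$, $H\circ\{u,w\}$ is the graph obtained by identifying $u$ and $w$, i.e. replacing them by a single vertex incident with all edges that were incident with $u$ or $w$; parallel edges are merged into one. If $u,w$ are adjacent in $H$, the identified graph has a loop, hence no proper coloring and $f(H\circ\{u,w\},t)=0$; equivalently, $f(H\circ\{u,w\},t)$ counts the proper $t$-colorings of $H$ in which $u$ and $w$ receive the same color. $H\cup\{e_1,e_2,\dots\}$ denotes $H$ with the edges $e_1,e_2,\dots$ added (an edge already present is not doubled). *)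

theory Defs
  imports "HOL-Analysis.Analysis" "Graph_Theory.Pair_Digraph"
begin

text \<open>
  A finite simple undirected graph is a \<^locale>\<open>pair_graph\<close>: a finite vertex set with a symmetric,
  irreflexive set of arcs, an edge \<open>xy\<close> being the pair of arcs \<open>(x, y)\<close>, \<open>(y, x)\<close>. The type
  \<^typ>\<open>'a pair_pre_digraph\<close> excludes parallel edges but admits loops, which identification of
  adjacent vertices produces.
\<close>

definition neighbors :: "'a pair_pre_digraph \<Rightarrow> 'a \<Rightarrow> 'a set" where
  "neighbors G v = {u. (v, u) \<in> parcs G}"

definition pdel_vert :: "'a pair_pre_digraph \<Rightarrow> 'a \<Rightarrow> 'a pair_pre_digraph" where
  "pdel_vert G v =
     \<lparr>pverts = pverts G - {v}, parcs = {e \<in> parcs G. fst e \<noteq> v \<and> snd e \<noteq> v}\<rparr>"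

lemma with_proj_pdel_vert: "with_proj (pdel_vert G v) = pre_digraph.del_vert (with_proj G) v"
  by (simp add: with_proj_def pdel_vert_def pre_digraph.del_vert_def)

text \<open>Each listed pair \<open>(x, y)\<close> stands for the undirected edge \<open>xy\<close>.\<close>

definition add_edges :: "'a pair_pre_digraph \<Rightarrow> ('a \<times> 'a) set \<Rightarrow> 'a pair_pre_digraph" where
  "add_edges G E = \<lparr>pverts = pverts G, parcs = parcs G \<union> E \<union> E\<inverse>\<rparr>"

text \<open>
  In \<open>H \<circ> {u, w}\<close> the merged vertex keeps the name \<open>u\<close>. An edge \<open>uw\<close> of \<open>H\<close> becomes a loop at \<open>u\<close>.
\<close>

definition identify :: "'a pair_pre_digraph \<Rightarrow> 'a \<Rightarrow> 'a \<Rightarrow> 'a pair_pre_digraph" where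
  "identify H u w =
     (let r = (\<lambda>x. if x = w then u else x)
      in \<lparr>pverts = r ` pverts H, parcs = map_prod r r ` parcs H\<rparr>)"

text \<open>
  Colorings are extensional functions (\<^const>\<open>undefined\<close> off the vertex set), so that each one is
  counted once. A graph with a loop has no proper coloring.
\<close>

definition proper_colorings :: "'a pair_pre_digraph \<Rightarrow> nat \<Rightarrow> ('a \<Rightarrow> nat) set" where
  "proper_colorings G t =
     {c \<in> pverts G \<rightarrow>\<^sub>E {..<t}. \<forall>(x, y) \<in> parcs G. c x \<noteq> c y}"

definition chromatic_value :: "'a pair_pre_digraph \<Rightarrow> nat \<Rightarrow> nat" where
  "chromatic_value G t = card (proper_colorings G t)"

text \<open>
  A drawing places the vertices at distinct points and each edge \<open>xy\<close> on an arc \<open>\<gamma> {x, y}\<close> (a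
  homeomorphic image of the unit interval) joining its ends, such that an arc meets no vertex but its
  own ends and two different arcs meet only in vertices. Indexing \<open>\<gamma>\<close> by the two-element set
  \<open>{x, y}\<close> gives the arcs \<open>(x, y)\<close> and \<open>(y, x)\<close> the same curve.
\<close>

definition plane_drawing ::
    "'a pair_pre_digraph \<Rightarrow> ('a \<Rightarrow> real^2) \<Rightarrow> ('a set \<Rightarrow> real \<Rightarrow> real^2) \<Rightarrow> bool" where
  "plane_drawing G p \<gamma> \<longleftrightarrow>
     inj_on p (pverts G) \<and>
     (\<forall>(x, y) \<in> parcs G.
        arc (\<gamma> {x, y}) \<and>
        {pathstart (\<gamma> {x, y}), pathfinish (\<gamma> {x, y})} = {p x, p y} \<and>
        path_image (\<gamma> {x, y}) \<inter> p ` pverts G = {p x, p y}) \<and>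
     (\<forall>(x, y) \<in> parcs G. \<forall>(x', y') \<in> parcs G. {x, y} \<noteq> {x', y'} \<longrightarrow>
        path_image (\<gamma> {x, y}) \<inter> path_image (\<gamma> {x', y'}) \<subseteq> p ` pverts G)"

definition planar :: "'a pair_pre_digraph \<Rightarrow> bool" where
  "planar G \<longleftrightarrow> (\<exists>p \<gamma>. plane_drawing G p \<gamma>)"

definition maximal_planar :: "'a pair_pre_digraph \<Rightarrow> bool" where
  "maximal_planar G \<longleftrightarrow>
     pair_graph G \<and> planar G \<and>
     (\<forall>x \<in> pverts G. \<forall>y \<in> pverts G.
        x \<noteq> y \<and> (x, y) \<notin> parcs G \<longrightarrow> \<not> planar (add_edges G {(x, y)}))"

end

theory Submission
  imports Defs
begin

text \<open>
  Each \<open>4\<close>-coloring of \<open>G - v\<close> extends to \<open>v\<close> in as many ways as there are colors missing on the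
  pentagon \<open>v1 v2 v3 v4 v5\<close>. A pentagon needs at least three colors, so \<open>f(G, 4)\<close> counts the
  colorings of \<open>G - v\<close> using exactly three colors there. Such a coloring splits the pentagon into
  two non-adjacent pairs and a singleton. The first bracket counts the colorings where the singleton
  is \<open>v3\<close> or \<open>v4\<close>, the second those where it is \<open>v1\<close> or \<open>v5\<close>, and the third those where it is
  \<open>v2\<close>.
\<close>

lemma finite_proper_colorings: "finite (pverts G) \<Longrightarrow> finite (proper_colorings G t)"
  unfolding proper_colorings_def by (simp add: finite_PiE)

lemma add_edges_empty: "add_edges G {} = G"
  by (simp add: add_edges_def)

text \<open>Colorings of the identified graph pull back along the merging map to exactly those
  colorings of \<open>H\<close> that agree on \<open>u\<close> and \<open>w\<close>. The merged
  vertex is called \<open>u\<close>, so the edges in \<open>E\<close> must not name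
  \<open>w\<close>; their constraints then read the same on both sides. If \<open>u\<close> and
  \<open>w\<close> are adjacent in \<open>H\<close>, the loop makes both counts zero.\<close>

lemma chromatic_value_identify_add_edges:
  assumes u: "u \<in> pverts H" and w: "w \<in> pverts H" and "u \<noteq> w"
    and E: "\<forall>(x, y) \<in> E. x \<noteq> w \<and> y \<noteq> w"
  shows "chromatic_value (add_edges (identify H u w) E) t =
    card {c \<in> proper_colorings H t. c u = c w \<and> (\<forall>(x, y) \<in> E. c x \<noteq> c y)}"
proof -
  define r where "r = (\<lambda>x. if x = w then u else x)"
  let ?K = "add_edges (identify H u w) E"
  have V: "pverts ?K = pverts H - {w}"
    using u w \<open>u \<noteq> w\<close> by (auto simp: add_edges_def identify_def Let_def)
  have A: "parcs ?K = map_prod r r ` parcs H \<union> E \<union> E\<inverse>"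
    by (simp add: add_edges_def identify_def r_def Let_def)
  have "bij_betw (\<lambda>c. c(w := c u)) (proper_colorings ?K t)
      {c \<in> proper_colorings H t. c u = c w \<and> (\<forall>(x, y) \<in> E. c x \<noteq> c y)}"
  proof (rule bij_betwI[where g = "\<lambda>c. c(w := undefined)"])
    show "(\<lambda>c. c(w := c u)) \<in> proper_colorings ?K t \<rightarrow>
        {c \<in> proper_colorings H t. c u = c w \<and> (\<forall>(x, y) \<in> E. c x \<noteq> c y)}"
    proof
      fix c assume c: "c \<in> proper_colorings ?K t"
      let ?c = "c(w := c u)"
      have cV: "c \<in> (pverts H - {w}) \<rightarrow>\<^sub>E {..<t}"
        and cA: "\<forall>(x, y) \<in> map_prod r r ` parcs H \<union> E \<union> E\<inverse>. c x \<noteq> c y"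
        using c unfolding proper_colorings_def V A by auto
      \<comment> \<open>The extended coloring is \<open>c\<close> composed with \<open>r\<close>, so
        properness on the arcs of \<open>H\<close> is properness on their images.\<close>
      have eq: "?c x = c (r x)" for x
        by (simp add: r_def)
      have "?c \<in> pverts H \<rightarrow>\<^sub>E {..<t}"
        using cV u w \<open>u \<noteq> w\<close> by (auto simp: PiE_iff extensional_def)
      moreover have "\<forall>(x, y) \<in> parcs H. ?c x \<noteq> ?c y"
        unfolding eq using cA by force
      moreover have "\<forall>(x, y) \<in> E. ?c x \<noteq> ?c y"
        using cA E by fastforce
      ultimately show "?c \<in> {c \<in> proper_colorings H t. c u = c w \<and> (\<forall>(x, y) \<in> E. c x \<noteq> c y)}"
        using \<open>u \<noteq> w\<close> by (simp add: proper_colorings_def)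
    qed
    show "(\<lambda>c. c(w := undefined)) \<in>
        {c \<in> proper_colorings H t. c u = c w \<and> (\<forall>(x, y) \<in> E. c x \<noteq> c y)} \<rightarrow> proper_colorings ?K t"
    proof
      fix c assume "c \<in> {c \<in> proper_colorings H t. c u = c w \<and> (\<forall>(x, y) \<in> E. c x \<noteq> c y)}"
      then have cV: "c \<in> pverts H \<rightarrow>\<^sub>E {..<t}" and cA: "\<forall>(x, y) \<in> parcs H. c x \<noteq> c y"
        and uw: "c u = c w" and cE: "\<forall>(x, y) \<in> E. c x \<noteq> c y"
        by (auto simp: proper_colorings_def)
      let ?c = "c(w := undefined)"
      have "?c \<in> (pverts H - {w}) \<rightarrow>\<^sub>E {..<t}"
        using cV by (auto simp: PiE_iff extensional_def)
      moreover have "\<forall>(x, y) \<in> map_prod r r ` parcs H. ?c x \<noteq> ?c y"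
      proof clarify
        fix x y assume "(x, y) \<in> parcs H" and "?c (r x) = ?c (r y)"
        \<comment> \<open>\<open>r\<close> never takes the value \<open>w\<close>, so the reset at
          \<open>w\<close> is invisible, and it moves only \<open>w\<close>, to a vertex of the same
          color.\<close>
        moreover have "?c (r z) = c z" for z
          using uw \<open>u \<noteq> w\<close> by (simp add: r_def)
        ultimately show False
          using cA by (auto simp only:)
      qed
      moreover have "\<forall>(x, y) \<in> E \<union> E\<inverse>. ?c x \<noteq> ?c y"
        using cE E by fastforce
      ultimately show "?c \<in> proper_colorings ?K t"
        unfolding proper_colorings_def V A by blast
    qed
    show "(c(w := c u))(w := undefined) = c" if "c \<in> proper_colorings ?K t" for c
      using that unfolding proper_colorings_def V by (auto simp: PiE_iff extensional_def)
    show "(c(w := undefined))(w := (c(w := undefined)) u) = c"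
      if "c \<in> {c \<in> proper_colorings H t. c u = c w \<and> (\<forall>(x, y) \<in> E. c x \<noteq> c y)}" for c
      using that \<open>u \<noteq> w\<close> by auto
  qed
  then show ?thesis
    unfolding chromatic_value_def by (rule bij_betw_same_card)
qed

lemma chromatic_value_pdel_vert:
  assumes G: "pair_graph G" and v: "v \<in> pverts G"
  shows "chromatic_value G t =
    (\<Sum>c \<in> proper_colorings (pdel_vert G v) t. card ({..<t} - c ` neighbors G v))"
proof -
  interpret pair_graph G by fact
  let ?H = "pdel_vert G v" and ?N = "neighbors G v"
  have nv: "v \<notin> ?N"
    using no_loops[of "(v, v)"] by (auto simp: neighbors_def)
  \<comment> \<open>\<open>neighbors\<close> looks only at arcs leaving \<open>v\<close>; symmetry
    also covers those entering it.\<close>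
  have sym: "(x, y) \<in> parcs G \<longleftrightarrow> (y, x) \<in> parcs G" for x y
    using arcs_symmetric by blast
  have "bij_betw (\<lambda>(c, k). c(v := k))
      (SIGMA c:proper_colorings ?H t. {..<t} - c ` ?N) (proper_colorings G t)"
  proof (rule bij_betwI[where g = "\<lambda>c. (c(v := undefined), c v)"])
    show "(\<lambda>(c, k). c(v := k)) \<in>
        (SIGMA c:proper_colorings ?H t. {..<t} - c ` ?N) \<rightarrow> proper_colorings G t"
    proof
      fix p assume "p \<in> (SIGMA c:proper_colorings ?H t. {..<t} - c ` ?N)"
      then obtain c k where p: "p = (c, k)"
        and c: "c \<in> proper_colorings ?H t" and k: "k \<in> {..<t}" "k \<notin> c ` ?N"
        by blast
      have "c(v := k) \<in> pverts G \<rightarrow>\<^sub>E {..<t}"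
        using c k v by (auto simp: proper_colorings_def pdel_vert_def PiE_iff extensional_def)
      moreover have "(c(v := k)) x \<noteq> (c(v := k)) y" if xy: "(x, y) \<in> parcs G" for x y
      proof -
        have "x \<noteq> y" using no_loops[OF xy] by simp
        moreover have "y \<in> ?N" if "x = v" using xy that by (simp add: neighbors_def)
        moreover have "x \<in> ?N" if "y = v" using xy that sym by (simp add: neighbors_def)
        moreover have "c x \<noteq> c y" if "x \<noteq> v" "y \<noteq> v"
          using c xy that by (auto simp: proper_colorings_def pdel_vert_def)
        ultimately show ?thesis using k by auto
      qed
      ultimately show "(\<lambda>(c, k). c(v := k)) p \<in> proper_colorings G t"
        unfolding proper_colorings_def p prod.case by blast
    qed
    show "(\<lambda>c. (c(v := undefined), c v)) \<in>
        proper_colorings G t \<rightarrow> (SIGMA c:proper_colorings ?H t. {..<t} - c ` ?N)"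
    proof
      fix c assume c: "c \<in> proper_colorings G t"
      let ?c = "c(v := undefined)"
      have "?c \<in> proper_colorings ?H t"
        using c by (auto simp: proper_colorings_def pdel_vert_def PiE_iff extensional_def)
      moreover have "c v < t"
        using c v by (auto simp: proper_colorings_def)
      moreover have "?c ` ?N = c ` ?N"
        using nv by (intro image_cong) auto
      moreover have "c v \<notin> c ` ?N"
        using c by (auto simp: proper_colorings_def neighbors_def)
      ultimately show "(?c, c v) \<in> (SIGMA c:proper_colorings ?H t. {..<t} - c ` ?N)"
        by simp
    qed
  qed (auto simp: proper_colorings_def pdel_vert_def PiE_iff extensional_def)
  then have "chromatic_value G t = card (SIGMA c:proper_colorings ?H t. {..<t} - c ` ?N)"
    unfolding chromatic_value_def by (rule bij_betw_same_card[symmetric])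
  also have "\<dots> = (\<Sum>c \<in> proper_colorings ?H t. card ({..<t} - c ` ?N))"
    by (rule card_SigmaI) (auto simp: finite_proper_colorings pdel_vert_def)
  finally show ?thesis .
qed

text \<open>Each difference is the indicator that the stated pair agrees and at least one further
  inequality fails. Thus the first is 1 when \<open>b = e\<close> and \<open>a\<close> equals
  \<open>d\<close> or \<open>c\<close>, leaving \<open>c\<close> or \<open>d\<close> respectively as
  the singleton. The five possible singletons are mutually exclusive; if all four colors occur, only
  one pair agrees and every difference vanishes.\<close>

lemma pentagon_missing_colors:
  fixes a b c d e :: nat
  assumes "a < 4" "b < 4" "c < 4" "d < 4" "e < 4"
    and "a \<noteq> b" "b \<noteq> c" "c \<noteq> d" "d \<noteq> e" "e \<noteq> a"
  shows "int (card ({..<4} - {a, b, c, d, e})) =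
      (of_bool (b = e) - of_bool (b = e \<and> a \<noteq> d \<and> a \<noteq> c))
    + (of_bool (b = d) - of_bool (b = d \<and> c \<noteq> a \<and> c \<noteq> e))
    + (of_bool (c = e) - of_bool (c = e \<and> d \<noteq> a))"
proof -
  have four: "{..<4} = {0, 1, 2, 3 :: nat}"
    by auto
  have cases: "x = 0 \<or> x = 1 \<or> x = 2 \<or> x = 3" if "x < 4" for x :: nat
    using that by auto
  \<comment> \<open>Exhaustion over the 4^5 assignments; the improper ones contradict the five
    inequalities.\<close>
  show ?thesis
    using cases[OF assms(1)] cases[OF assms(2)] cases[OF assms(3)] cases[OF assms(4)]
      cases[OF assms(5)] assms(6-10)
    unfolding four by (elim disjE) (simp_all add: insert_Diff_if)
qed

theorem theorem3p8:
  fixes G :: "'a pair_pre_digraph" and v v1 v2 v3 v4 v5 :: 'a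
  assumes "maximal_planar G"
    and "v \<in> pverts G"
    and "out_degree (with_proj G) v = 5"
    and "neighbors G v = {v1, v2, v3, v4, v5}"
    and "pre_digraph.cycle (with_proj G) [(v1, v2), (v2, v3), (v3, v4), (v4, v5), (v5, v1)]"
  defines "G1 \<equiv> identify (pdel_vert G v) v2 v5"
    and "G2 \<equiv> identify (pdel_vert G v) v2 v4"
    and "G3 \<equiv> identify (pdel_vert G v) v3 v5"
  shows "int (chromatic_value G 4) =
      (int (chromatic_value G1 4) - int (chromatic_value (add_edges G1 {(v1, v4), (v1, v3)}) 4))
    + (int (chromatic_value G2 4) - int (chromatic_value (add_edges G2 {(v3, v1), (v3, v5)}) 4))
    + (int (chromatic_value G3 4) - int (chromatic_value (add_edges G3 {(v4, v1)}) 4))"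
proof -
  let ?H = "pdel_vert G v"
  let ?P = "proper_colorings ?H 4"
  have G: "pair_graph G"
    using assms(1) by (simp add: maximal_planar_def)
  interpret pair_graph G by fact
  have fin: "finite ?P"
    by (rule finite_proper_colorings) (simp add: pdel_vert_def)
  \<comment> \<open>A cycle is a closed walk repeating no vertex except its endpoint, which gives
    both the distinctness and the five pentagon edges.\<close>
  have dist: "distinct [v1, v2, v3, v4, v5]" "v5 \<noteq> v4"
    and arcs: "{(v1, v2), (v2, v3), (v3, v4), (v4, v5), (v5, v1)} \<subseteq> parcs G"
    using assms(5) by (auto simp: cycle_def awalk_def cas.simps)
  have nv: "v \<notin> {v1, v2, v3, v4, v5}"
    using no_loops[of "(v, v)"] unfolding assms(4)[symmetric] by (auto simp: neighbors_def)
  have V: "{v1, v2, v3, v4, v5} \<subseteq> pverts ?H"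
    using nv arcs wellformed by (fastforce simp: pdel_vert_def)
  have arcsH: "{(v1, v2), (v2, v3), (v3, v4), (v4, v5), (v5, v1)} \<subseteq> parcs ?H"
    using arcs nv by (auto simp: pdel_vert_def)
  \<comment> \<open>Written as sums of indicators over the common set \<open>?P\<close>, all seven
    chromatic values can be compared coloring by coloring.\<close>
  have ind: "int (card {c \<in> ?P. Q c}) = (\<Sum>c\<in>?P. of_bool (Q c))" for Q
    using fin by (simp add: sum.If_cases of_bool_def Collect_conj_eq)
  have contract: "int (chromatic_value (add_edges (identify ?H u w) E) 4) =
      (\<Sum>c\<in>?P. of_bool (c u = c w \<and> (\<forall>(x, y) \<in> E. c x \<noteq> c y)))"
    if "u \<in> pverts ?H" "w \<in> pverts ?H" "u \<noteq> w" "\<forall>(x, y) \<in> E. x \<noteq> w \<and> y \<noteq> w" for u w E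
    unfolding ind[symmetric] using chromatic_value_identify_add_edges[OF that] by simp
  have contract': "int (chromatic_value (identify ?H u w) 4) = (\<Sum>c\<in>?P. of_bool (c u = c w))"
    if "u \<in> pverts ?H" "w \<in> pverts ?H" "u \<noteq> w" for u w
    using contract[OF that, of "{}"] by (simp add: add_edges_empty)
  have brackets:
    "int (chromatic_value G1 4) = (\<Sum>c\<in>?P. of_bool (c v2 = c v5))"
    "int (chromatic_value G2 4) = (\<Sum>c\<in>?P. of_bool (c v2 = c v4))"
    "int (chromatic_value G3 4) = (\<Sum>c\<in>?P. of_bool (c v3 = c v5))"
    "int (chromatic_value (add_edges G1 {(v1, v4), (v1, v3)}) 4) =
      (\<Sum>c\<in>?P. of_bool (c v2 = c v5 \<and> c v1 \<noteq> c v4 \<and> c v1 \<noteq> c v3))"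
    "int (chromatic_value (add_edges G2 {(v3, v1), (v3, v5)}) 4) =
      (\<Sum>c\<in>?P. of_bool (c v2 = c v4 \<and> c v3 \<noteq> c v1 \<and> c v3 \<noteq> c v5))"
    "int (chromatic_value (add_edges G3 {(v4, v1)}) 4) =
      (\<Sum>c\<in>?P. of_bool (c v3 = c v5 \<and> c v4 \<noteq> c v1))"
    \<comment> \<open>By distinctness no added edge ends at the absorbed vertex (\<open>v5\<close>,
      \<open>v4\<close>, \<open>v5\<close> respectively). The rule \<open>sum_of_bool_eq\<close> is
      withheld because it would turn the sums back into cardinalities.\<close>
    unfolding G1_def G2_def G3_def using V dist
    by (simp_all add: contract' contract del: sum_of_bool_eq)
  have pointwise: "int (card ({..<4} - c ` neighbors G v)) =
      (of_bool (c v2 = c v5) - of_bool (c v2 = c v5 \<and> c v1 \<noteq> c v4 \<and> c v1 \<noteq> c v3))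
    + (of_bool (c v2 = c v4) - of_bool (c v2 = c v4 \<and> c v3 \<noteq> c v1 \<and> c v3 \<noteq> c v5))
    + (of_bool (c v3 = c v5) - of_bool (c v3 = c v5 \<and> c v4 \<noteq> c v1))" if "c \<in> ?P" for c
  proof -
    have "c x < 4" if "x \<in> {v1, v2, v3, v4, v5}" for x
      using \<open>c \<in> ?P\<close> that V by (auto simp: proper_colorings_def PiE_iff)
    moreover have "c x \<noteq> c y" if "(x, y) \<in> parcs ?H" for x y
      using \<open>c \<in> ?P\<close> that by (auto simp: proper_colorings_def)
    \<comment> \<open>The pentagon survives the deletion of \<open>v\<close>, so \<open>c\<close> is
      proper along it and the pentagon lemma applies to the colors of \<open>v1\<close> to
      \<open>v5\<close> in cyclic order.\<close>
    ultimately show ?thesis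
      unfolding assms(4) image_insert image_empty
      using arcsH by (intro pentagon_missing_colors) auto
  qed
  have "int (chromatic_value G 4) = (\<Sum>c\<in>?P. int (card ({..<4} - c ` neighbors G v)))"
    using chromatic_value_pdel_vert[OF G assms(2)] by simp
  also have "\<dots> = (\<Sum>c\<in>?P.
      (of_bool (c v2 = c v5) - of_bool (c v2 = c v5 \<and> c v1 \<noteq> c v4 \<and> c v1 \<noteq> c v3))
    + (of_bool (c v2 = c v4) - of_bool (c v2 = c v4 \<and> c v3 \<noteq> c v1 \<and> c v3 \<noteq> c v5))
    + (of_bool (c v3 = c v5) - of_bool (c v3 = c v5 \<and> c v4 \<noteq> c v1)))"
    by (rule sum.cong[OF refl pointwise])
  also have "\<dots> =
      (int (chromatic_value G1 4) - int (chromatic_value (add_edges G1 {(v1, v4), (v1, v3)}) 4))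
    + (int (chromatic_value G2 4) - int (chromatic_value (add_edges G2 {(v3, v1), (v3, v5)}) 4))
    + (int (chromatic_value G3 4) - int (chromatic_value (add_edges G3 {(v4, v1)}) 4))"
    by (simp only: brackets sum.distrib sum_subtractf)
  finally show ?thesis .
qed

end
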